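(* Let $q$ be a prime power of characteristic $p$, $r\geqslant1$, and let $d$ be a positive integer with $\gcd(d,p)=1$. Then $f(X)=X^{-d}\in\mathbb{F}_{q^r}(X)$ belongs to $\mathcal{F}_d(q)$.
   Context: $\mathcal{F}_d(q)$ is the set of rational functions $f(X)\in\mathbb{F}_{q^r}(X)$ of degree $d$ such that for every $\omega\in\mathbb{F}_{q^r}^*$ the function $f(X+\omega)-f(X)$ is not of the form $\alpha(g(X)^p-g(X))+\beta X$ for any rational function $g(X)\in\overline{\mathbb{F}_q}(X)$ and any $\alpha,\beta\in\mathbb{F}_{q^r}$; here $\overline{\mathbb{F}_q}$ is the algebraic closure of $\mathbb{F}_q$. *)

theory Defs
  imports "HOL-Algebra.Algebraic_Closure_Type"
begin

text \<open>The field \<open>K(X)\<close> of rational functions is rendered as the type \<open>K poly fract\<close>.\<close>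

definition rf_const :: "'k::field \<Rightarrow> 'k poly fract" where
  "rf_const c = to_fract [:c:]"

definition rf_X :: "'k::field poly fract" where
  "rf_X = to_fract [:0, 1:]"

text \<open>The degree of a rational function is \<open>max (deg a) (deg b)\<close>, where \<open>a / b\<close> is any
  representation in lowest terms; lemma \<open>rf_degree_Fract\<close> below shows independence of the choice.\<close>

definition rf_degree :: "'k::field poly fract \<Rightarrow> nat" where
  "rf_degree f = (THE n. \<exists>a b. b \<noteq> 0 \<and> coprime a b \<and> f = Fract a b \<and> n = max (degree a) (degree b))"

lemma coprime_poly_bezout:
  fixes a b :: "'k::field poly"
  assumes "coprime a b"
  shows "\<exists>s t. s * a + t * b = 1"
  using assms
proof (induction "if b = 0 then 0 else Suc (degree b)" arbitrary: a b rule: less_induct)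
  case less
  show ?case
  proof (cases "b = 0")
    case True
    with less.prems have "a dvd 1" by simp
    then obtain s where "1 = a * s" by (rule dvdE)
    then have "s * a + 0 * b = 1" by (simp add: mult.commute)
    then show ?thesis by blast
  next
    case False
    have "coprime b (a mod b)"
    proof (rule coprimeI)
      fix c assume "c dvd b" "c dvd a mod b"
      then have "c dvd a" by (simp add: dvd_mod_iff)
      with \<open>c dvd b\<close> less.prems show "is_unit c" by (intro coprime_common_divisor)
    qed
    moreover have "a mod b = 0 \<or> degree (a mod b) < degree b"
      using False by (rule degree_mod_less)
    moreover from this have "(if a mod b = 0 then 0 else Suc (degree (a mod b)))
        < (if b = 0 then 0 else Suc (degree b))"
      using False by auto
    ultimately obtain s t where st: "s * b + t * (a mod b) = 1"
      using less.hyps by blast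
    have "t * a + (s - t * (a div b)) * b = s * b + t * (a - a div b * b)"
      by (simp add: algebra_simps)
    also have "a - a div b * b = a mod b"
      by (rule minus_div_mult_eq_mod)
    finally show ?thesis using st by auto
  qed
qed

lemma coprime_poly_dvd_mult:
  fixes a b c :: "'k::field poly"
  assumes "coprime a b" "b dvd a * c"
  shows "b dvd c"
proof -
  obtain s t where st: "s * a + t * b = 1"
    using coprime_poly_bezout[OF assms(1)] by blast
  have "b dvd s * (a * c) + b * (t * c)"
    using dvd_mult[OF assms(2)] by (rule dvd_add) simp
  also have "s * (a * c) + b * (t * c) = (s * a + t * b) * c"
    by (simp add: algebra_simps)
  finally show ?thesis by (simp add: st)
qed

lemma rf_degree_Fract:
  fixes a b :: "'k::field poly"
  assumes "b \<noteq> 0" "coprime a b"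
  shows "rf_degree (Fract a b) = max (degree a) (degree b)"
  unfolding rf_degree_def
proof (rule the_equality)
  show "\<exists>a' b'. b' \<noteq> 0 \<and> coprime a' b' \<and> Fract a b = Fract a' b' \<and>
          max (degree a) (degree b) = max (degree a') (degree b')"
    using assms by blast
next
  fix n
  assume "\<exists>a' b'. b' \<noteq> 0 \<and> coprime a' b' \<and> Fract a b = Fract a' b' \<and>
            n = max (degree a') (degree b')"
  then obtain a' b' where *: "b' \<noteq> 0" "coprime a' b'" "Fract a b = Fract a' b'"
      "n = max (degree a') (degree b')"
    by blast
  have eq: "a * b' = a' * b"
    using * assms by (simp add: eq_fract)
  have "b dvd b'"
  proof -
    have "b dvd a * b'" by (simp add: eq)
    then show ?thesis
      using coprime_poly_dvd_mult[OF assms(2)] by blast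
  qed
  moreover have "b' dvd b"
  proof -
    have "b' dvd a' * b" by (simp add: eq [symmetric])
    then show ?thesis
      using coprime_poly_dvd_mult[OF *(2)] by blast
  qed
  ultimately have db: "degree b = degree b'"
    using assms(1) *(1) by (simp add: dvd_imp_degree_le order_antisym)
  have "degree a = degree a'"
  proof (cases "a = 0 \<or> a' = 0")
    case True
    then have "a = 0" "a' = 0" using eq assms(1) *(1) by auto
    then show ?thesis by simp
  next
    case False
    then have "degree a + degree b' = degree a' + degree b"
      using eq assms(1) *(1) by (auto simp flip: degree_mult_eq)
    with db show ?thesis by simp
  qed
  with db * show "n = max (degree a) (degree b)" by simp
qed

text \<open>The map \<open>K(X) \<rightarrow> L(X)\<close> induced by an injective ring homomorphism \<open>h : K[X] \<rightarrow> L[X]\<close>, sending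
  \<open>a / b\<close> to \<open>h a / h b\<close>. For such \<open>h\<close>, the value does not depend on the representation
  (lemma \<open>rf_map_Fract\<close>); the definition is only used for such \<open>h\<close>.\<close>

definition rf_map :: "('k::field poly \<Rightarrow> 'l::field poly) \<Rightarrow> 'k poly fract \<Rightarrow> 'l poly fract" where
  "rf_map h f = (THE u. \<exists>a b. b \<noteq> 0 \<and> f = Fract a b \<and> u = Fract (h a) (h b))"

lemma rf_map_Fract:
  assumes mult: "\<And>x y. h (x * y) = h x * h y"
    and nz: "\<And>x. h x = 0 \<longleftrightarrow> x = 0"
    and b: "b \<noteq> 0"
  shows "rf_map h (Fract a b) = Fract (h a) (h b)"
  unfolding rf_map_def
proof (rule the_equality)
  show "\<exists>a' b'. b' \<noteq> 0 \<and> Fract a b = Fract a' b' \<and> Fract (h a) (h b) = Fract (h a') (h b')"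
    using b by blast
next
  fix u
  assume "\<exists>a' b'. b' \<noteq> 0 \<and> Fract a b = Fract a' b' \<and> u = Fract (h a') (h b')"
  then obtain a' b' where *: "b' \<noteq> 0" "Fract a b = Fract a' b'" "u = Fract (h a') (h b')"
    by blast
  then have "a * b' = a' * b"
    using b by (simp add: eq_fract)
  then have "h a * h b' = h a' * h b"
    by (simp flip: mult)
  then show "u = Fract (h a) (h b)"
    using * b by (simp add: eq_fract nz)
qed

text \<open>\<open>rf_shift \<omega> f\<close> is \<open>f(X + \<omega>)\<close>.\<close>

definition rf_shift :: "'k::field \<Rightarrow> 'k poly fract \<Rightarrow> 'k poly fract" where
  "rf_shift \<omega> = rf_map (\<lambda>a. pcompose a [:\<omega>, 1:])"

lemma rf_shift_Fract:
  "b \<noteq> 0 \<Longrightarrow> rf_shift \<omega> (Fract a b) = Fract (pcompose a [:\<omega>, 1:]) (pcompose b [:\<omega>, 1:])"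
  unfolding rf_shift_def by (rule rf_map_Fract) (auto simp: pcompose_mult pcompose_eq_0_iff)

text \<open>\<open>rf_to_ac\<close> is the embedding of \<open>K(X)\<close> into \<open>L(X)\<close>, where \<open>L\<close> is the algebraic closure
  of \<open>K\<close>.\<close>

definition rf_to_ac :: "'k::field poly fract \<Rightarrow> 'k alg_closure poly fract" where
  "rf_to_ac = rf_map (map_poly to_ac)"

lemma rf_to_ac_Fract:
  "b \<noteq> 0 \<Longrightarrow> rf_to_ac (Fract a b) = Fract (map_poly to_ac a) (map_poly to_ac b)"
  unfolding rf_to_ac_def
proof (rule rf_map_Fract)
  show "map_poly to_ac (x * y) = map_poly to_ac x * map_poly to_ac y" for x y :: "'k::field poly"
    by (intro poly_eqI) (simp add: coeff_map_poly coeff_mult to_ac_sum)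
  show "map_poly to_ac x = 0 \<longleftrightarrow> x = 0" for x :: "'k::field poly"
    by (simp add: map_poly_eq_0_iff)
qed

text \<open>The class \<open>\<F>\<^sub>d(q)\<close>. The type \<open>'k\<close> plays the role of the field with \<open>q\<^sup>r\<close> elements, and its
  algebraic closure is also the algebraic closure of the subfield with \<open>q\<close> elements;
  \<open>CHAR('k)\<close> is the characteristic \<open>p\<close>.\<close>

definition rf_class :: "nat \<Rightarrow> 'k::{field,finite} poly fract set" where
  "rf_class d = {f. rf_degree f = d \<and>
     (\<forall>\<omega>. \<omega> \<noteq> 0 \<longrightarrow>
       \<not> (\<exists>(g :: 'k alg_closure poly fract) (\<alpha> :: 'k) (\<beta> :: 'k).
            rf_to_ac (rf_shift \<omega> f - f) =
              rf_const (to_ac \<alpha>) * (g ^ CHAR('k) - g) + rf_const (to_ac \<beta>) * rf_X))}"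

end

theory Submission
  imports Defs "HOL-Computational_Algebra.Normalized_Fraction" "HOL-Number_Theory.Residues"
begin

text \<open>At a pole of order \<open>m\<close> of \<open>g\<close>, the function \<open>g\<^sup>p - g\<close> has a pole of order \<open>p m\<close>. Hence every
  finite pole of \<open>\<alpha> (g\<^sup>p - g) + \<beta> X\<close> has order divisible by \<open>p\<close>, whereas \<open>(X + \<omega>)\<^sup>-\<^sup>d - X\<^sup>-\<^sup>d\<close> has a pole
  of order \<open>d\<close> at \<open>0\<close> when \<open>\<omega> \<noteq> 0\<close>.\<close>

lemma order_power:
  fixes f :: "'a::idom poly"
  assumes "f \<noteq> 0"
  shows "order c (f ^ n) = n * order c f"
  by (induction n) (use assms in \<open>auto simp: order_mult\<close>)

text \<open>Supplies gcds of polynomials over the closure, so that \<open>quot_of_fract\<close> can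
  put \<open>g\<close> in lowest terms.\<close>

instance alg_closure :: (field) field_gcd ..

lemma map_poly_to_ac_mult:
  "map_poly to_ac (x * y) = map_poly to_ac x * map_poly to_ac y" for x y :: "'k::field poly"
  by (intro poly_eqI) (simp add: coeff_map_poly coeff_mult to_ac_sum)

lemma map_poly_to_ac_power:
  "map_poly to_ac (x ^ n) = map_poly to_ac x ^ n" for x :: "'k::field poly"
  by (induction n) (simp_all add: map_poly_to_ac_mult)

lemma poly_map_poly_to_ac:
  "poly (map_poly to_ac x) (to_ac c) = to_ac (poly x c)" for x :: "'k::field poly"
  by (induction x) (simp_all add: map_poly_pCons)

text \<open>Split off the full power of \<open>[:- c, 1:]\<close>; the cofactor does not vanish at
  \<open>c\<close>, and still does not after the injective map \<open>to_ac\<close>. Pole orders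
  over the closure can thus be computed over the base field.\<close>

lemma order_map_poly_to_ac:
  fixes x :: "'k::field poly"
  assumes "x \<noteq> 0"
  shows "order (to_ac c) (map_poly to_ac x) = order c x"
proof -
  obtain y where x: "x = [:- c, 1:] ^ order c x * y" and "\<not> [:- c, 1:] dvd y"
    using order_decomp[OF assms] by blast
  then have "poly (map_poly to_ac y) (to_ac c) \<noteq> 0"
    by (simp add: poly_map_poly_to_ac poly_eq_0_iff_dvd)
  then have y: "map_poly to_ac y \<noteq> 0" "order (to_ac c) (map_poly to_ac y) = 0"
    by (auto intro: order_0I)
  have "map_poly to_ac x = [:- to_ac c, 1:] ^ order c x * map_poly to_ac y"
    by (subst x) (simp add: map_poly_to_ac_mult map_poly_to_ac_power map_poly_pCons)
  then show ?thesis
    using y by (simp add: order_mult order_power_n_n)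
qed

text \<open>As \<open>A\<close> does not vanish at \<open>c\<close>, the order of \<open>B\<close>
  there is the pole order of the fraction, even if \<open>A\<close> and \<open>B\<close> share
  factors elsewhere. At a pole, it equals \<open>p\<close> times the order of the reduced
  denominator of \<open>g\<close>.\<close>

lemma dvd_pole_order_Artin_Schreier:
  fixes A B :: "'k::field_gcd poly" and g :: "'k poly fract"
  assumes "p \<ge> 2" "B \<noteq> 0" "poly A c \<noteq> 0"
    and eq: "Fract A B = rf_const \<alpha> * (g ^ p - g) + rf_const \<beta> * rf_X"
  shows "p dvd order c B"
proof (cases "poly B c = 0")
  case False
  then show ?thesis by (simp add: order_0I)
next
  case True
  define a b where "a = fst (quot_of_fract g)" and "b = snd (quot_of_fract g)"
  have b: "b \<noteq> 0" and g: "g = Fract a b" and "coprime a b"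
    by (simp_all add: a_def b_def coprime_quot_of_fract)
  \<comment> \<open>The numerator of the right-hand side over the common denominator
    \<open>b ^ p\<close>.\<close>
  define M where "M = smult \<alpha> (a ^ p - a * b ^ (p - 1)) + [:0, \<beta>:] * b ^ p"
  have bp: "b ^ p = b * b ^ (p - 1)"
    using assms(1) by (simp flip: power_Suc)
  have "g ^ n = Fract (a ^ n) (b ^ n)" for n
    by (induction n) (simp_all add: One_fract_def g)
  moreover have "g = Fract (a * b ^ (p - 1)) (b ^ p)"
    using b by (simp add: g eq_fract bp mult_ac)
  ultimately have "g ^ p - g = Fract (a ^ p) (b ^ p) - Fract (a * b ^ (p - 1)) (b ^ p)"
    by metis
  also have "\<dots> = Fract (a ^ p - a * b ^ (p - 1)) (b ^ p)"
    using b by (simp add: eq_fract algebra_simps)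
  finally have "g ^ p - g = Fract (a ^ p - a * b ^ (p - 1)) (b ^ p)" .
  then have "Fract A B = Fract M (b ^ p)"
    using b by (simp add: eq rf_const_def rf_X_def to_fract_def eq_fract M_def smult_diff_right algebra_simps)
  then have AM: "A * b ^ p = M * B"
    using b \<open>B \<noteq> 0\<close> by (simp add: eq_fract)
  have A: "A \<noteq> 0" "order c A = 0"
    using assms(3) by (auto intro: order_0I)
  \<comment> \<open>The pole at \<open>c\<close> must come from \<open>g\<close>: \<open>b\<close>
    vanishes there, hence by coprimality \<open>a\<close> does not.\<close>
  have "poly (A * b ^ p) c = 0"
    using True by (simp add: AM)
  then have "poly b c = 0"
    using assms(3) by simp
  then have "poly a c \<noteq> 0"
    using coprime_poly_bezout[OF \<open>coprime a b\<close>] by (metis add_0 mult_zero_right poly_1 poly_add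
        poly_mult zero_neq_one)
  \<comment> \<open>With \<alpha> = 0 the right-hand side would be the polynomial \<beta> X, which
    has no pole at \<open>c\<close>.\<close>
  have "\<alpha> \<noteq> 0"
  proof
    assume "\<alpha> = 0"
    then have "b ^ p * A = b ^ p * ([:0, \<beta>:] * B)"
      using AM by (simp add: M_def algebra_simps)
    then have "A = [:0, \<beta>:] * B"
      using b by (subst (asm) mult_left_cancel) simp_all
    with True assms(3) show False by simp
  qed
  \<comment> \<open>The value is \<alpha> times the \<open>p\<close>-th power of
    \<open>poly a c\<close>: every other term contains a factor \<open>b\<close>, including
    \<open>b ^ (p - 1)\<close> because \<open>p \<ge> 2\<close>.\<close>
  then have "poly M c \<noteq> 0"
    using \<open>poly b c = 0\<close> \<open>poly a c \<noteq> 0\<close> assms(1) by (simp add: M_def power_0_left)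
  then have "M \<noteq> 0" "order c M = 0"
    by (auto intro: order_0I)
  \<comment> \<open>Compare orders at \<open>c\<close> in \<open>A * b ^ p = M * B\<close>, where
    \<open>A\<close> and \<open>M\<close> contribute nothing.\<close>
  then have "order c B = order c (M * B)"
    using \<open>B \<noteq> 0\<close> by (simp add: order_mult)
  also have "\<dots> = p * order c b"
    using A b by (simp add: order_mult order_power flip: AM)
  finally show ?thesis by simp
qed

text \<open>The characteristic of a finite field is prime and divides the cardinality, whose only
  possible prime divisor is \<open>p\<close>.\<close>

lemma CHAR_eq_prime_power_card:
  assumes "prime p" "card (UNIV :: 'k::{field,finite} set) = p ^ n"
  shows "CHAR('k) = p"
proof -
  have "prime CHAR('k)"
    by (rule prime_CHAR_semidom) (simp add: finite_imp_CHAR_pos)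
  moreover have "CHAR('k) dvd p ^ n"
    using CHAR_dvd_CARD[where 'a = 'k] assms(2) by simp
  ultimately show ?thesis
    using assms(1) prime_dvd_power primes_dvd_imp_eq by blast
qed

theorem theorem2p8:
  fixes p q n r d :: nat
  assumes "prime p" and "n \<ge> 1" and "q = p ^ n"
    and "r \<ge> 1"
    and "card (UNIV :: 'k::{field,finite} set) = q ^ r"
    and "d > 0" and "gcd d p = 1"
  shows "(rf_X :: 'k poly fract) powi (- int d) \<in> rf_class d"
proof -
  define Z :: "'k poly" where "Z = [:0, 1:]"
  have Z: "Z \<noteq> 0" by (simp add: Z_def)
  have CHAR: "CHAR('k) = p"
    using assms by (intro CHAR_eq_prime_power_card[of p "n * r"]) (simp_all add: power_mult)
  have "to_fract Z ^ m = Fract (Z ^ m) 1" for m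
    by (induction m) (simp_all add: One_fract_def to_fract_def)
  then have f: "(rf_X :: 'k poly fract) powi (- int d) = Fract 1 (Z ^ d)"
    by (simp add: rf_X_def Z_def power_int_minus)
  have "rf_degree (Fract 1 (Z ^ d)) = d"
    using Z by (subst rf_degree_Fract) (simp_all add: degree_power_eq, simp add: Z_def)
  moreover have False
    if "\<omega> \<noteq> 0" and eq: "rf_to_ac (rf_shift \<omega> (Fract 1 (Z ^ d)) - Fract 1 (Z ^ d)) =
      rf_const (to_ac \<alpha>) * (g ^ CHAR('k) - g) + rf_const (to_ac \<beta>) * rf_X"
    for \<omega> \<alpha> \<beta> :: 'k and g
  proof -
    \<comment> \<open>Numerator and denominator of 1/(X + \<omega>)^d - 1/X^d over the product of
      the denominators.\<close>
    define A B where "A = Z ^ d - [:\<omega>, 1:] ^ d" and "B = [:\<omega>, 1:] ^ d * Z ^ d"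
    have B: "B \<noteq> 0" by (simp add: B_def Z)
    have "pcompose (Z ^ d) [:\<omega>, 1:] = [:\<omega>, 1:] ^ d"
      by (induction d) (simp_all add: Z_def pcompose_1 pcompose_mult pcompose_pCons)
    then have "rf_shift \<omega> (Fract 1 (Z ^ d)) - Fract 1 (Z ^ d) = Fract A B"
      using Z by (simp add: rf_shift_Fract pcompose_1 A_def B_def)
    with eq B have "Fract (map_poly to_ac A) (map_poly to_ac B) =
        rf_const (to_ac \<alpha>) * (g ^ p - g) + rf_const (to_ac \<beta>) * rf_X"
      by (simp add: rf_to_ac_Fract CHAR)
    \<comment> \<open>At 0 the numerator is -\<omega>^d, since X^d vanishes there for
      \<open>d > 0\<close>. The point is written \<open>to_ac 0\<close> so that the order can be
      transferred back to the base field.\<close>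
    moreover have "poly (map_poly to_ac A) (to_ac 0) \<noteq> 0"
      unfolding poly_map_poly_to_ac using \<open>\<omega> \<noteq> 0\<close> \<open>d > 0\<close> by (simp add: A_def Z_def power_0_left)
    ultimately have "p dvd order (to_ac 0) (map_poly to_ac B)"
      using B \<open>prime p\<close>
      by (intro dvd_pole_order_Artin_Schreier) (auto simp: prime_ge_2_nat map_poly_eq_0_iff)
    also have "order (to_ac 0) (map_poly to_ac B) = order 0 B"
      using B by (rule order_map_poly_to_ac)
    \<comment> \<open>The factor (X + \<omega>)^d is nonzero at 0, so only X^d contributes.\<close>
    also have "\<dots> = d"
      using B \<open>\<omega> \<noteq> 0\<close> order_power_n_n[of "0::'k" d]
      by (simp add: B_def Z_def order_mult order_0I)
    \<comment> \<open>Now \<open>p\<close> divides \<open>d\<close>, so \<open>gcd d p = p\<close>,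
      which would force \<open>p = 1\<close>.\<close>
    finally show False
      using assms by (metis gcd_nat.absorb2 not_prime_1)
  qed
  ultimately show ?thesis
    unfolding rf_class_def f by blast
qed

end
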